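(* Let $\{\gamma^{(k)}\}_{k\in\mathbb{N}}$ be the sequence generated by the AMQ algorithm (described in the context) with initial point $\gamma^{(0)}\in\mathbb{R}^n_{++}$, parameter $\tau>0$ and step sizes $\eta^{(k)}>0$. Let $R>0$ be a constant with $\gamma_i^{(k)}\le R$ for all $1\le i\le n$, $k\ge0$, and set $$A_k=\eta^{(k)}\sum_{i=1}^n\big[(x_i^{(k)})^2+\tau\big]\big(\theta_i^{(k+\frac12)}-\theta_i^{(k)}\big)^2,\qquad B_k=(\eta^{(k)})^2\sum_{i=1}^n\Big[(x_i^{(k)})^2+\frac{9R}{5}\Big]\big(\theta_i^{(k+\frac12)}-\theta_i^{(k)}\big)^2.$$ If the step sizes $\eta^{(k)}$ are chosen such that $B_k\le A_k$ for all $k\ge0$, then: (i) The sequence $\{L(\gamma^{(k)})\}$ is monotonically decreasing (non-increasing) and converges. (ii) There exists a subsequence $\{n_k\}$ of $\mathbb{N}$ such that both $\{x^{(n_k)}\}$ and $\{\gamma^{(n_k)}\}$ converge. (iii) For a subsequence $\{n_k\}$ as in (ii), if additionally $\sum_{k=0}^\infty\eta^{(n_k)}=\infty$ and there exists a constant $\kappa\in[0,1)$ such that $B_k\le\kappa A_k$ for all $k\in\mathbb{N}$, then for each $1\le i\le n$, either $\gamma_i^*=0$ or $\frac{\partial L}{\partial\gamma_i}(\gamma^* )=0$, where $\gamma^*=\lim_{k\to\infty}\gamma^{(n_k)}$.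
   Context: Setting: $\mathsf F\in\mathbb{R}^{m\times n}$, $y\in\mathbb{R}^m$, $\beta>0$. $\mathbb{R}^n_{+}$ and $\mathbb{R}^n_{++}$ are the vectors with nonnegative, respectively positive, entries. For $\gamma\in\mathbb{R}^n_+$: $\Gamma=\operatorname{diag}(\gamma)$, $S(\gamma)=\beta^{-1}I+\mathsf F\Gamma\mathsf F^{T}$, $\mu(\gamma)=\Gamma\mathsf F^{T}S(\gamma)^{-1}y$, $Z(\gamma)=\mathsf F^{T}S(\gamma)^{-1}\mathsf F$, and $$L(\gamma)=y^{T}S(\gamma)^{-1}y+\log\det S(\gamma).$$ AMQ algorithm: given $\gamma^{(0)}\in\mathbb{R}^n_{++}$ and $\tau>0$, for $k\ge0$ set $x^{(k)}=\mu(\gamma^{(k)})$, $\theta_i^{(k)}=(\gamma_i^{(k)})^{-1/2}$, and for $1\le i\le n$ $$\theta_i^{(k+\frac12)}=\frac{(\theta_i^{(k)})^{-3}[Z(\gamma^{(k)})]_{ii}+\tau\theta_i^{(k)}}{(x_i^{(k)})^2+\tau},\qquad \theta_i^{(k+1)}=\theta_i^{(k)}+\eta^{(k)}\big(\theta_i^{(k+\frac12)}-\theta_i^{(k)}\big),\qquad \gamma_i^{(k+1)}=(\theta_i^{(k+1)})^{-2}.$$ (Here $\theta^{(k+\frac12)}$ is the minimizer over $\theta\in\mathbb{R}^n_{++}$ of $\sum_i(x_i^{(k)})^2\theta_i^2+\langle\nabla\Psi(\theta^{(k)}),\theta-\theta^{(k)}\rangle+\tau\|\theta-\theta^{(k)}\|^2$,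 with $\Psi(\theta)=\log\det(\beta^{-1}I+\mathsf F\operatorname{diag}(\theta_i^{-2})\mathsf F^T)$.) The step sizes $\eta^{(k)}>0$ are such that all iterates $\theta^{(k)}$ lie in $\mathbb{R}^n_{++}$. *)

theory Defs
  imports "HOL-Analysis.Analysis"
begin

definition diag_mat :: "real^'n \<Rightarrow> real^'n^'n" where
  "diag_mat v = (\<chi> i j. if i = j then v $ i else 0)"

definition Smat :: "real^'n^'m \<Rightarrow> real \<Rightarrow> real^'n \<Rightarrow> real^'m^'m" where
  "Smat F \<beta> \<gamma> = mat (inverse \<beta>) + F ** diag_mat \<gamma> ** transpose F"

definition post_mean :: "real^'n^'m \<Rightarrow> real^'m \<Rightarrow> real \<Rightarrow> real^'n \<Rightarrow> real^'n" where
  "post_mean F y \<beta> \<gamma> = (diag_mat \<gamma> ** transpose F ** matrix_inv (Smat F \<beta> \<gamma>)) *v y"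

definition Zmat :: "real^'n^'m \<Rightarrow> real \<Rightarrow> real^'n \<Rightarrow> real^'n^'n" where
  "Zmat F \<beta> \<gamma> = transpose F ** matrix_inv (Smat F \<beta> \<gamma>) ** F"

text \<open>The cost is meaningful only where \<open>Smat F \<beta> \<gamma>\<close> is positive definite, in particular
  for \<open>\<beta> > 0\<close> and all \<open>\<gamma>\<close> with nonnegative entries.\<close>

definition cost :: "real^'n^'m \<Rightarrow> real^'m \<Rightarrow> real \<Rightarrow> real^'n \<Rightarrow> real" where
  "cost F y \<beta> \<gamma> = y \<bullet> (matrix_inv (Smat F \<beta> \<gamma>) *v y) + ln (det (Smat F \<beta> \<gamma>))"

definition has_partial_derivative :: "(real^'n \<Rightarrow> real) \<Rightarrow> 'n \<Rightarrow> real^'n \<Rightarrow> real \<Rightarrow> bool" where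
  "has_partial_derivative f i v D \<longleftrightarrow>
     ((\<lambda>t. f (\<chi> j. if j = i then t else v $ j)) has_real_derivative D) (at (v $ i))"

text \<open>The sequences \<open>\<gamma>\<close>, \<open>x\<close>, \<open>\<theta>\<close> and \<open>\<theta>h\<close> (where \<open>\<theta>h k\<close> is the half step
  between \<open>\<theta> k\<close> and \<open>\<theta> (Suc k)\<close>) are produced by the AMQ algorithm with step sizes \<open>\<eta>\<close>.
  Positivity of all \<open>\<theta> k\<close> is included: it is what the step sizes are required to ensure,
  and it makes \<open>\<theta> k $ i = \<gamma> k $ i powr (-1/2)\<close> and the update of \<open>\<gamma>\<close> consistent.\<close>

definition AMQ :: "real^'n^'m \<Rightarrow> real^'m \<Rightarrow> real \<Rightarrow> real \<Rightarrow> (nat \<Rightarrow> real) \<Rightarrow>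
    (nat \<Rightarrow> real^'n) \<Rightarrow> (nat \<Rightarrow> real^'n) \<Rightarrow> (nat \<Rightarrow> real^'n) \<Rightarrow> (nat \<Rightarrow> real^'n) \<Rightarrow> bool" where
  "AMQ F y \<beta> \<tau> \<eta> \<gamma> x \<theta> \<theta>h \<longleftrightarrow>
     (\<forall>i. 0 < \<gamma> 0 $ i) \<and>
     (\<forall>k. 0 < \<eta> k) \<and>
     (\<forall>k i. 0 < \<theta> k $ i) \<and>
     (\<forall>k. x k = post_mean F y \<beta> (\<gamma> k)) \<and>
     (\<forall>k i. \<theta> k $ i = \<gamma> k $ i powr (-1/2)) \<and>
     (\<forall>k i. \<theta>h k $ i =
        ((\<theta> k $ i) powi (-3) * Zmat F \<beta> (\<gamma> k) $ i $ i + \<tau> * \<theta> k $ i) / ((x k $ i)\<^sup>2 + \<tau>)) \<and>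
     (\<forall>k i. \<theta> (Suc k) $ i = \<theta> k $ i + \<eta> k * (\<theta>h k $ i - \<theta> k $ i)) \<and>
     (\<forall>k i. \<gamma> (Suc k) $ i = (\<theta> (Suc k) $ i) powi (-2))"

definition A_AMQ :: "real \<Rightarrow> (nat \<Rightarrow> real) \<Rightarrow> (nat \<Rightarrow> real^'n) \<Rightarrow> (nat \<Rightarrow> real^'n) \<Rightarrow>
    (nat \<Rightarrow> real^'n) \<Rightarrow> nat \<Rightarrow> real" where
  "A_AMQ \<tau> \<eta> x \<theta> \<theta>h k =
     \<eta> k * (\<Sum>i\<in>UNIV. ((x k $ i)\<^sup>2 + \<tau>) * (\<theta>h k $ i - \<theta> k $ i)\<^sup>2)"

definition B_AMQ :: "real \<Rightarrow> (nat \<Rightarrow> real) \<Rightarrow> (nat \<Rightarrow> real^'n) \<Rightarrow> (nat \<Rightarrow> real^'n) \<Rightarrow>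
    (nat \<Rightarrow> real^'n) \<Rightarrow> nat \<Rightarrow> real" where
  "B_AMQ R \<eta> x \<theta> \<theta>h k =
     (\<eta> k)\<^sup>2 * (\<Sum>i\<in>UNIV. ((x k $ i)\<^sup>2 + 9 * R / 5) * (\<theta>h k $ i - \<theta> k $ i)\<^sup>2)"

end

theory Submission
  imports Defs
begin

text \<open>
  For fixed \<open>\<gamma>\<close> the data term \<open>y \<bullet> S(\<gamma>)\<inverse> y\<close> is the minimum over \<open>x\<close> of
  \<open>\<beta> \<parallel>y - F x\<parallel>\<^sup>2 + (\<Sum>i. x\<^sub>i\<^sup>2 / \<gamma>\<^sub>i)\<close>, attained at \<open>x = \<mu>(\<gamma>)\<close>, and \<open>log det S\<close> is concave
  in \<open>\<gamma>\<close>. Freezing \<open>x\<close> at the current iterate and replacing \<open>log det S\<close> by its tangent majorizes the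
  cost by a sum of functions of one coordinate each. As \<open>\<gamma>\<^sub>i Z\<^sub>i\<^sub>i \<le> 1\<close>, the tangent in \<open>\<gamma>\<close> exceeds
  the one in \<open>\<theta>\<close> by at most \<open>3 R (\<theta>'\<^sub>i - \<theta>\<^sub>i)\<^sup>2\<close> per coordinate, so that one step decreases the cost
  by at least \<open>2 (A\<^sub>k - B\<^sub>k)\<close>. The cost is bounded below by \<open>log det S(0)\<close>. If \<open>B\<^sub>k \<le> \<kappa> A\<^sub>k\<close>, the
  \<open>A\<^sub>k\<close> are therefore summable, whereas \<open>A\<^sub>k \<ge> \<eta>\<^sub>k \<gamma>\<^sub>i\<^sup>3 (\<partial>L/\<partial>\<gamma>\<^sub>i)\<^sup>2 / (x\<^sub>i\<^sup>2 + \<tau>)\<close>; since the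
  step sizes are not summable along the subsequence, the partial derivative must vanish in the
  limit wherever \<open>\<gamma>\<^sub>i > 0\<close>.
\<close>

subsection \<open>The matrix \<open>S(\<gamma>)\<close> and its inverse\<close>

lemma matrix_inv_right_left:
  fixes A :: "real^'n^'n"
  assumes "invertible A"
  shows "A ** matrix_inv A = mat 1" "matrix_inv A ** A = mat 1"
  using someI_ex[OF assms[unfolded invertible_def]] unfolding matrix_inv_def by auto

lemma diag_mat_mult_vec: "diag_mat c *v v = (\<chi> i. c $ i * v $ i)"
  by (simp add: diag_mat_def matrix_vector_mult_def vec_eq_iff if_distrib[where f = "\<lambda>a. a * _"] cong: if_cong)

lemma trace_diag_mat_mult: "trace (diag_mat c ** W) = (\<Sum>i\<in>UNIV. c $ i * W $ i $ i)"
  by (simp add: trace_def diag_mat_def matrix_matrix_mult_def if_distrib[where f = "\<lambda>a. a * _"] cong: if_cong)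

text \<open>The vector \<open>v v* F\<close> is F^T v; the computations below use it in this form,
  with one column of \<open>F\<close> for each coordinate of \<gamma>.\<close>

lemma vector_matrix_mult_nth: "(v v* F) $ i = v \<bullet> column i (F :: real^'n^'m)"
  by (simp add: vector_matrix_mult_def inner_vec_def column_def mult.commute)

lemma congruence_nth:
  fixes F :: "real^'n^'m"
  shows "(transpose F ** M ** F) $ i $ j = column i F \<bullet> (M *v column j F)"
proof -
  have "(transpose F ** M ** F) $ i $ j = (transpose F *v (M *v (F *v axis j 1))) $ i"
    by (simp only: matrix_vector_mul_assoc matrix_vector_mul_component) (simp add: inner_axis matrix_mul_assoc)
  then show ?thesis
    by (simp add: matrix_vector_mult_basis vector_matrix_mult_nth inner_commute)
qed

text \<open>Cyclicity of the trace moves \<open>F\<close> to the right, which leaves a diagonal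
  matrix against F^T M F. With M the inverse of S, the quadratic forms in the sum are the diagonal
  entries of Z.\<close>

lemma trace_congruence_diag:
  fixes F :: "real^'n^'m"
  shows "trace (F ** diag_mat c ** transpose F ** M) = (\<Sum>i\<in>UNIV. c $ i * (column i F \<bullet> (M *v column i F)))"
proof -
  have "trace (F ** diag_mat c ** transpose F ** M) = trace (F ** (diag_mat c ** (transpose F ** M)))"
    by (simp add: matrix_mul_assoc)
  also have "\<dots> = trace (diag_mat c ** (transpose F ** M ** F))"
    by (subst trace_mul_sym) (simp add: matrix_mul_assoc)
  finally show ?thesis by (simp add: trace_diag_mat_mult congruence_nth)
qed

lemma mat_mult_vec: "mat c *v v = c *\<^sub>R (v :: real^'n)"
  by (simp add: mat_def matrix_vector_mult_def vec_eq_iff if_distrib[where f = "\<lambda>a. a * _"] cong: if_cong)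

lemma trace_mat_mult: "trace (mat c ** M) = c * trace (M :: real^'n^'n)"
  by (simp add: trace_def mat_def matrix_matrix_mult_def sum_distrib_left if_distrib[where f = "\<lambda>a. a * _"] cong: if_cong)

lemma matrix_add_rdistrib: "(A + B) ** C = A ** C + B ** (C :: real^'n^'m)"
  by (simp add: matrix_matrix_mult_def vec_eq_iff sum.distrib algebra_simps)

lemma trace_Smat_mult:
  "trace (Smat F \<beta> \<gamma> ** M) = inverse \<beta> * trace M + (\<Sum>i\<in>UNIV. \<gamma> $ i * (column i F \<bullet> (M *v column i F)))"
  by (simp add: Smat_def matrix_add_rdistrib trace_add trace_mat_mult trace_congruence_diag)

lemma Smat_mult_vec:
  "Smat F \<beta> \<gamma> *v v = inverse \<beta> *\<^sub>R v + F *v (\<chi> i. \<gamma> $ i * (v v* F) $ i)"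
  by (simp add: Smat_def matrix_vector_mult_add_rdistrib mat_mult_vec diag_mat_mult_vec
      flip: matrix_vector_mul_assoc)

lemma inner_Smat:
  "u \<bullet> (Smat F \<beta> \<gamma> *v v) = inverse \<beta> * (u \<bullet> v) + (\<Sum>i\<in>UNIV. \<gamma> $ i * (u v* F) $ i * (v v* F) $ i)"
proof -
  have "u \<bullet> (F *v (\<chi> i. \<gamma> $ i * (v v* F) $ i)) = (\<Sum>i\<in>UNIV. \<gamma> $ i * (u v* F) $ i * (v v* F) $ i)"
    by (subst dot_lmul_matrix[symmetric]) (simp add: inner_vec_def mult_ac)
  then show ?thesis by (simp add: Smat_mult_vec inner_add_right)
qed

lemma inner_Smat_commute: "u \<bullet> (Smat F \<beta> \<gamma> *v v) = (Smat F \<beta> \<gamma> *v u) \<bullet> v"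
  by (subst (2) inner_commute) (simp add: inner_Smat mult_ac inner_commute)

lemma inner_Smat_ge:
  assumes "\<And>i. 0 \<le> \<gamma> $ i"
  shows "inverse \<beta> * (v \<bullet> v) \<le> v \<bullet> (Smat F \<beta> \<gamma> *v v)"
  by (simp add: inner_Smat sum_nonneg assms mult.assoc)

text \<open>The quadratic form of S dominates \<open>inverse \<beta>\<close> times the squared norm,
  so the kernel is trivial.\<close>

lemma invertible_Smat:
  assumes "\<beta> > 0" "\<And>i. 0 \<le> \<gamma> $ i"
  shows "invertible (Smat F \<beta> \<gamma>)"
  unfolding invertible_left_inverse matrix_left_invertible_ker
proof (intro allI impI)
  fix v assume "Smat F \<beta> \<gamma> *v v = 0"
  with inner_Smat_ge[OF assms(2), of \<beta> v F] have "inverse \<beta> * (v \<bullet> v) \<le> 0" by simp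
  with \<open>\<beta> > 0\<close> have "\<not> 0 < v \<bullet> v"
    by (metis inverse_positive_iff_positive mult_pos_pos not_less)
  then show "v = 0" by (metis inner_gt_zero_iff)
qed

lemma Smat_inv_vec:
  assumes "\<beta> > 0" "\<And>i. 0 \<le> \<gamma> $ i"
  shows "Smat F \<beta> \<gamma> *v (matrix_inv (Smat F \<beta> \<gamma>) *v v) = v"
  by (simp add: matrix_vector_mul_assoc matrix_inv_right_left[OF invertible_Smat[OF assms]])

lemma inner_Smat_inv_commute:
  assumes "\<beta> > 0" "\<And>i. 0 \<le> \<gamma> $ i"
  shows "u \<bullet> (matrix_inv (Smat F \<beta> \<gamma>) *v v) = (matrix_inv (Smat F \<beta> \<gamma>) *v u) \<bullet> v"
  by (metis Smat_inv_vec[OF assms] inner_Smat_commute)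

lemma inner_Smat_inv_nonneg:
  assumes "\<beta> > 0" "\<And>i. 0 \<le> \<gamma> $ i"
  shows "0 \<le> v \<bullet> (matrix_inv (Smat F \<beta> \<gamma>) *v v)"
proof -
  let ?p = "matrix_inv (Smat F \<beta> \<gamma>) *v v"
  have "0 \<le> inverse \<beta> * (?p \<bullet> ?p)" using assms(1) by simp
  also have "\<dots> \<le> ?p \<bullet> (Smat F \<beta> \<gamma> *v ?p)" by (rule inner_Smat_ge[OF assms(2)])
  also have "\<dots> = v \<bullet> ?p" by (simp add: Smat_inv_vec[OF assms] inner_commute)
  finally show ?thesis .
qed

lemma Zmat_nth: "Zmat F \<beta> \<gamma> $ i $ j = column i F \<bullet> (matrix_inv (Smat F \<beta> \<gamma>) *v column j F)"
  by (simp add: Zmat_def congruence_nth)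

lemma Zmat_diag_nonneg:
  assumes "\<beta> > 0" "\<And>i. 0 \<le> \<gamma> $ i"
  shows "0 \<le> Zmat F \<beta> \<gamma> $ i $ i"
  by (simp add: Zmat_nth inner_Smat_inv_nonneg[OF assms])

text \<open>With p = S^(-1) f for the column f of \<open>F\<close>, the entry z = Z_ii equals p . f
  = p . S p. Keeping only the i-th term of this quadratic form gives \<gamma>_i z^2 <= z, and z can
  be cancelled unless it vanishes.\<close>

lemma mult_Zmat_diag_le_1:
  assumes "\<beta> > 0" "\<And>i. 0 \<le> \<gamma> $ i"
  shows "\<gamma> $ i * Zmat F \<beta> \<gamma> $ i $ i \<le> 1"
proof -
  let ?p = "matrix_inv (Smat F \<beta> \<gamma>) *v column i F"
  let ?z = "Zmat F \<beta> \<gamma> $ i $ i"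
  have z: "(?p v* F) $ i = ?z" by (simp add: vector_matrix_mult_nth Zmat_nth inner_commute)
  have "\<gamma> $ i * ?z * ?z = \<gamma> $ i * (?p v* F) $ i * (?p v* F) $ i" by (simp add: z)
  also have "\<dots> \<le> (\<Sum>j\<in>UNIV. \<gamma> $ j * (?p v* F) $ j * (?p v* F) $ j)"
    by (rule member_le_sum) (auto simp: assms(2) mult.assoc)
  also have "\<dots> \<le> ?p \<bullet> (Smat F \<beta> \<gamma> *v ?p)" using assms(1) by (simp add: inner_Smat)
  also have "\<dots> = ?z" by (simp add: Smat_inv_vec[OF assms] Zmat_nth inner_commute)
  finally have "\<gamma> $ i * ?z * ?z \<le> 1 * ?z" by simp
  then show ?thesis
    using Zmat_diag_nonneg[OF assms, of F i] by (cases "?z = 0") (auto simp: mult_le_cancel_right)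
qed

lemma trace_Smat_inv_mult_nonneg:
  assumes "\<beta> > 0" "\<And>i. 0 \<le> \<gamma> $ i"
    and Q: "\<And>v. 0 \<le> v \<bullet> (Q *v v)"
  shows "0 \<le> trace (matrix_inv (Smat F \<beta> \<gamma>) ** Q)"
proof -
  \<comment> \<open>Writing \<open>P = P S P\<close> for the inverse \<open>P\<close> of \<open>S\<close> exhibits \<open>P\<close> as a Gram matrix.\<close>
  let ?S = "Smat F \<beta> \<gamma>" and ?P = "matrix_inv (Smat F \<beta> \<gamma>)"
  have psd: "0 \<le> v \<bullet> ((?P ** Q ** ?P) *v v)" for v
    using Q[of "?P *v v"]
    by (simp add: inner_Smat_inv_commute[OF assms(1,2)] flip: matrix_vector_mul_assoc)
  have diag: "0 \<le> (?P ** Q ** ?P) $ i $ i" for i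
    using psd[of "axis i 1"] by (simp add: matrix_vector_mult_basis inner_axis' column_def)
  have "trace (?P ** Q) = trace ((?P ** Q ** ?P) ** ?S)"
    by (simp add: matrix_inv_right_left[OF invertible_Smat[OF assms(1,2)]] flip: matrix_mul_assoc)
  also have "\<dots> = trace (?S ** (?P ** Q ** ?P))"
    by (rule trace_mul_sym)
  also have "\<dots> \<ge> 0"
    unfolding trace_Smat_mult using assms(1,2)
    by (auto simp: trace_def diag psd intro!: add_nonneg_nonneg mult_nonneg_nonneg sum_nonneg)
  finally show ?thesis .
qed

subsection \<open>Concavity of \<open>log det S\<close>\<close>

lemma DERIV_det_mat_1: "((\<lambda>s. det (mat 1 + s *\<^sub>R M)) has_real_derivative trace M) (at 0)"
  for M :: "real^'n^'n"
proof -
  \<comment> \<open>Every permutation other than the identity moves two points, so its term vanishes to second order.\<close>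
  have vanish: "(\<Prod>j\<in>UNIV - {i}. (mat 1 :: real^'n^'n) $ j $ p j) = 0"
    if p: "p permutes UNIV" "p \<noteq> id" for p and i :: 'n
  proof -
    have "\<exists>j. j \<noteq> i \<and> p j \<noteq> j"
    proof (rule ccontr)
      assume "\<nexists>j. j \<noteq> i \<and> p j \<noteq> j"
      then have fixed: "p j = j" if "j \<noteq> i" for j using that by blast
      then have "p i = i" using permutes_inj[OF p(1)] by (metis injD)
      with fixed have "p = id" by (metis ext id_apply)
      with p(2) show False by simp
    qed
    then obtain j where "j \<noteq> i" "p j \<noteq> j" by blast
    then show ?thesis by (intro prod_zero) (auto simp: mat_def intro!: bexI[of _ j])
  qed
  have "(\<Sum>p\<in>{p. p permutes (UNIV :: 'n set)}. of_int (sign p) *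
      (\<Sum>i\<in>UNIV. M $ i $ p i * (\<Prod>j\<in>UNIV - {i}. (mat 1 + 0 *\<^sub>R M) $ j $ p j)))
    = (\<Sum>p\<in>{p. p permutes (UNIV :: 'n set)}. if p = id then trace M else 0)"
    by (rule sum.cong) (simp_all add: vanish trace_def sign_id, simp add: mat_def)
  also have "\<dots> = trace M"
    by (simp add: finite_permutations permutes_id)
  finally have *: "(\<Sum>p\<in>{p. p permutes (UNIV :: 'n set)}. of_int (sign p) *
      (\<Sum>i\<in>UNIV. M $ i $ p i * (\<Prod>j\<in>UNIV - {i}. (mat 1 + 0 *\<^sub>R M) $ j $ p j))) = trace M" .
  have "((\<lambda>s. (mat 1 + s *\<^sub>R M) $ i $ j) has_real_derivative M $ i $ j) (at 0)" for i j
    by (auto intro!: derivative_eq_intros)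
  then show ?thesis
    unfolding det_def *[symmetric]
    by (intro DERIV_sum DERIV_cmult has_field_derivative_prod)
qed

text \<open>Jacobi's formula: pulling the factor \<open>A\<close> out of the determinant reduces it
  to the derivative at the identity.\<close>

lemma DERIV_det_line:
  fixes A D :: "real^'n^'n"
  assumes "invertible A"
  shows "((\<lambda>s. det (A + s *\<^sub>R D)) has_real_derivative det A * trace (matrix_inv A ** D)) (at 0)"
proof -
  have "A + s *\<^sub>R D = A ** (mat 1 + s *\<^sub>R (matrix_inv A ** D))" for s
    by (simp add: matrix_add_ldistrib scalar_matrix_assoc[symmetric] matrix_scalar_ac matrix_mul_assoc
        matrix_inv_right_left[OF assms])
  then have "det (A + s *\<^sub>R D) = det A * det (mat 1 + s *\<^sub>R (matrix_inv A ** D))" for s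
    by (simp add: det_mul)
  then show ?thesis by (simp add: DERIV_cmult DERIV_det_mat_1)
qed

lemma transpose_diag_mat: "transpose (diag_mat c) = diag_mat c"
  by (simp add: diag_mat_def transpose_def vec_eq_iff)

lemma diag_mat_line: "diag_mat (\<gamma> + s *\<^sub>R c) = diag_mat \<gamma> + s *\<^sub>R diag_mat c"
  by (simp add: diag_mat_def vec_eq_iff)

lemma Smat_line:
  "Smat F \<beta> (\<gamma> + s *\<^sub>R c) = Smat F \<beta> \<gamma> + s *\<^sub>R (F ** diag_mat c ** transpose F)"
  by (simp add: Smat_def diag_mat_line matrix_add_ldistrib matrix_add_rdistrib matrix_scalar_ac
      scalar_matrix_assoc[symmetric] add.assoc)

lemma DERIV_det_Smat_line:
  assumes "\<beta> > 0" "\<And>i. 0 \<le> \<gamma> $ i + t * c $ i"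
  shows "((\<lambda>s. det (Smat F \<beta> (\<gamma> + s *\<^sub>R c))) has_real_derivative
    det (Smat F \<beta> (\<gamma> + t *\<^sub>R c)) * (\<Sum>i\<in>UNIV. c $ i * Zmat F \<beta> (\<gamma> + t *\<^sub>R c) $ i $ i)) (at t)"
proof -
  let ?g = "\<gamma> + t *\<^sub>R c" and ?D = "F ** diag_mat c ** transpose F"
  have nonneg: "0 \<le> ?g $ i" for i using assms(2) by simp
  have tr: "trace (matrix_inv (Smat F \<beta> ?g) ** ?D) = (\<Sum>i\<in>UNIV. c $ i * Zmat F \<beta> ?g $ i $ i)"
    by (subst trace_mul_sym) (simp add: trace_congruence_diag Zmat_nth)
  \<comment> \<open>The base point is moved to \<open>?g\<close>, where the derivative at 0 is
    known; 0 is written \<open>t - t\<close> so that \<open>DERIV_shift\<close> carries the result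
    back to the parameter \<open>t\<close>.\<close>
  have "((\<lambda>s. det (Smat F \<beta> ?g + s *\<^sub>R ?D)) has_real_derivative
    det (Smat F \<beta> ?g) * (\<Sum>i\<in>UNIV. c $ i * Zmat F \<beta> ?g $ i $ i)) (at (t - t))"
    unfolding tr[symmetric] using DERIV_det_line[OF invertible_Smat[OF assms(1) nonneg]] by simp
  then have "((\<lambda>s. det (Smat F \<beta> ?g + (s - t) *\<^sub>R ?D)) has_real_derivative
    det (Smat F \<beta> ?g) * (\<Sum>i\<in>UNIV. c $ i * Zmat F \<beta> ?g $ i $ i)) (at t)"
    using DERIV_shift[of "\<lambda>s. det (Smat F \<beta> ?g + s *\<^sub>R ?D)" _ t "- t"] by simp
  then show ?thesis
    by (simp add: Smat_line scaleR_diff_left)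
qed

lemma Smat_0: "Smat F \<beta> 0 = mat (inverse \<beta>)" for F :: "real^'n^'m"
proof -
  have "diag_mat 0 = (0 :: real^'n^'n)" by (auto simp: diag_mat_def vec_eq_iff)
  moreover have "F ** (0 :: real^'n^'n) ** transpose F = 0"
    by (simp add: matrix_matrix_mult_def vec_eq_iff)
  ultimately show ?thesis by (simp add: Smat_def)
qed

lemma det_Smat_pos:
  assumes "\<beta> > 0" "\<And>i. 0 \<le> \<gamma> $ i"
  shows "0 < det (Smat F \<beta> \<gamma>)"
proof (rule ccontr)
  \<comment> \<open>The determinant is positive at \<open>0\<close> and does not vanish on the segment from \<open>0\<close> to \<open>\<gamma>\<close>.\<close>
  let ?f = "\<lambda>t. det (Smat F \<beta> (0 + t *\<^sub>R \<gamma>))"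
  assume "\<not> 0 < det (Smat F \<beta> \<gamma>)"
  moreover have "0 \<le> ?f 0" using assms(1)
    by (simp add: Smat_0 det_diagonal mat_def)
  moreover have "isCont ?f t" if "0 \<le> t" for t
    using DERIV_isCont[OF DERIV_det_Smat_line[of \<beta> 0 t \<gamma> F]] that assms by simp
  ultimately obtain t where t: "0 \<le> t" "?f t = 0"
    using IVT2[of ?f 1 0 0] by auto
  have "invertible (Smat F \<beta> (0 + t *\<^sub>R \<gamma>))"
    by (rule invertible_Smat) (use assms t in auto)
  with t(2) show False by (simp add: invertible_det_nz)
qed

lemma DERIV_ln_det_Smat_line:
  assumes "\<beta> > 0" "\<And>i. 0 \<le> \<gamma> $ i + t * c $ i"
  shows "((\<lambda>s. ln (det (Smat F \<beta> (\<gamma> + s *\<^sub>R c)))) has_real_derivative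
    (\<Sum>i\<in>UNIV. c $ i * Zmat F \<beta> (\<gamma> + t *\<^sub>R c) $ i $ i)) (at t)"
proof -
  have "0 < det (Smat F \<beta> (\<gamma> + t *\<^sub>R c))"
    by (rule det_Smat_pos) (use assms in auto)
  with DERIV_det_Smat_line[where F=F, OF assms] show ?thesis
    by (auto intro!: derivative_eq_intros simp: field_simps)
qed

text \<open>Concavity in derivative form: the slope of log det S along a line is trace(P D), where P
  is the inverse of S and D the direction in which S moves. The slopes at the two points differ by t
  times trace(P D P' D), a trace of a product of two positive semidefinite matrices.\<close>

lemma trace_Zmat_line_antimono:
  assumes "\<beta> > 0" "\<And>i. 0 \<le> \<gamma> $ i" "\<And>i. 0 \<le> \<gamma> $ i + t * c $ i" "0 \<le> t"
  shows "(\<Sum>i\<in>UNIV. c $ i * Zmat F \<beta> (\<gamma> + t *\<^sub>R c) $ i $ i) \<le> (\<Sum>i\<in>UNIV. c $ i * Zmat F \<beta> \<gamma> $ i $ i)"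
proof -
  let ?P = "matrix_inv (Smat F \<beta> \<gamma>)" and ?P' = "matrix_inv (Smat F \<beta> (\<gamma> + t *\<^sub>R c))"
  let ?D = "F ** diag_mat c ** transpose F"
  have nonneg: "0 \<le> (\<gamma> + t *\<^sub>R c) $ i" for i using assms(3) by simp
  have tr: "trace (matrix_inv (Smat F \<beta> g) ** ?D) = (\<Sum>i\<in>UNIV. c $ i * Zmat F \<beta> g $ i $ i)" for g
    by (subst trace_mul_sym) (simp add: trace_congruence_diag Zmat_nth)
  have inv: "Smat F \<beta> \<gamma> ** ?P = mat 1" "?P ** Smat F \<beta> \<gamma> = mat 1"
    "Smat F \<beta> (\<gamma> + t *\<^sub>R c) ** ?P' = mat 1"
    using matrix_inv_right_left[OF invertible_Smat[OF assms(1,2)]]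
      matrix_inv_right_left[OF invertible_Smat[OF assms(1) nonneg]] by auto
  \<comment> \<open>The resolvent identity P - P' = t P D P', obtained by multiplying S' = S + t D
    with P on the left and P' on the right.\<close>
  have "?P' + t *\<^sub>R (?P ** ?D ** ?P') = ?P ** (Smat F \<beta> (\<gamma> + t *\<^sub>R c) ** ?P')"
    unfolding Smat_line
    by (simp add: matrix_add_ldistrib matrix_add_rdistrib matrix_mul_assoc inv
        matrix_scalar_ac scalar_matrix_assoc[symmetric])
  then have "?P = ?P' + t *\<^sub>R (?P ** ?D ** ?P')" by (simp add: inv)
  then have "trace (?P ** ?D) = trace ((?P' + t *\<^sub>R (?P ** ?D ** ?P')) ** ?D)" by simp
  also have "\<dots> = trace (?P' ** ?D) + t * trace (?P ** (?D ** ?P' ** ?D))"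
    by (simp add: matrix_add_rdistrib trace_add matrix_mul_assoc scalar_matrix_assoc[symmetric]
        trace_def sum.distrib sum_distrib_left)
  also have "\<dots> \<ge> trace (?P' ** ?D)"
  proof -
    \<comment> \<open>The direction \<open>?D\<close> may be indefinite, but it is symmetric, so the
      form of D P' D at v is that of P' at D v.\<close>
    have D: "u \<bullet> (?D *v v) = (?D *v u) \<bullet> v" for u v
    proof -
      have "u \<bullet> (?D *v v) = (transpose ?D *v u) \<bullet> v"
        by (simp add: dot_lmul_matrix)
      also have "transpose ?D = ?D"
        by (simp add: matrix_transpose_mul matrix_mul_assoc transpose_diag_mat)
      finally show ?thesis .
    qed
    have "v \<bullet> ((?D ** ?P' ** ?D) *v v) = (?D *v v) \<bullet> (?P' *v (?D *v v))" for v
      unfolding D[symmetric] by (simp only: matrix_vector_mul_assoc matrix_mul_assoc)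
    then have "0 \<le> trace (?P ** (?D ** ?P' ** ?D))"
      by (intro trace_Smat_inv_mult_nonneg[OF assms(1,2)])
        (simp only: inner_Smat_inv_nonneg[OF assms(1) nonneg])
    with assms(4) show ?thesis by simp
  qed
  finally show ?thesis by (simp add: tr)
qed

text \<open>By the mean value theorem the increment is the slope at an interior point of the
  segment, and the slope is largest at the starting point.\<close>

lemma ln_det_Smat_le_tangent:
  assumes "\<beta> > 0" "\<And>i. 0 \<le> \<gamma> $ i" "\<And>i. 0 \<le> \<gamma>' $ i"
  shows "ln (det (Smat F \<beta> \<gamma>')) \<le> ln (det (Smat F \<beta> \<gamma>)) + (\<Sum>i\<in>UNIV. (\<gamma>' $ i - \<gamma> $ i) * Zmat F \<beta> \<gamma> $ i $ i)"
proof -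
  let ?c = "\<gamma>' - \<gamma>"
  have seg: "0 \<le> \<gamma> $ i + t * ?c $ i" if "0 \<le> t" "t \<le> 1" for t i
  proof -
    have "\<gamma> $ i + t * ?c $ i = (1 - t) * \<gamma> $ i + t * \<gamma>' $ i" by (simp add: algebra_simps)
    with that assms show ?thesis by simp
  qed
  obtain t where t: "0 < t" "t < 1" and
    "ln (det (Smat F \<beta> (\<gamma> + 1 *\<^sub>R ?c))) - ln (det (Smat F \<beta> (\<gamma> + 0 *\<^sub>R ?c)))
      = (1 - 0) * (\<Sum>i\<in>UNIV. ?c $ i * Zmat F \<beta> (\<gamma> + t *\<^sub>R ?c) $ i $ i)"
    using MVT2[OF zero_less_one DERIV_ln_det_Smat_line[OF assms(1) seg, of _ F]] by auto
  with trace_Zmat_line_antimono[where F=F, OF assms(1,2) seg[of t]] show ?thesis by simp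
qed

subsection \<open>The cost function\<close>

lemma tendsto_det:
  fixes A :: "'a \<Rightarrow> real^'n^'n"
  assumes "\<And>i j. ((\<lambda>x. A x $ i $ j) \<longlongrightarrow> L $ i $ j) G"
  shows "((\<lambda>x. det (A x)) \<longlongrightarrow> det L) G"
  unfolding det_def by (intro tendsto_intros assms)

lemma tendsto_Smat:
  assumes "(g \<longlongrightarrow> \<gamma>) G"
  shows "((\<lambda>x. Smat F \<beta> (g x)) \<longlongrightarrow> Smat F \<beta> \<gamma>) G"
proof -
  have "((\<lambda>x. diag_mat (g x)) \<longlongrightarrow> diag_mat \<gamma>) G"
    by (intro vec_tendstoI) (auto simp: diag_mat_def intro!: tendsto_vec_nth assms)
  then show ?thesis
    unfolding Smat_def matrix_matrix_mult_def by (intro tendsto_intros) auto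
qed

text \<open>By Cramer's rule each coordinate is a quotient of determinants, which depend
  continuously on the entries, and the limit of the denominator is positive.\<close>

lemma tendsto_Smat_inv_vec:
  fixes F :: "real^'n^'m" and y :: "real^'m"
  assumes "\<beta> > 0" "(g \<longlongrightarrow> \<gamma>) G" "\<And>x i. 0 \<le> g x $ i" "\<And>i. 0 \<le> \<gamma> $ i"
  shows "((\<lambda>x. matrix_inv (Smat F \<beta> (g x)) *v b) \<longlongrightarrow> matrix_inv (Smat F \<beta> \<gamma>) *v b) G"
proof -
  let ?C = "\<lambda>A k. \<chi> i j. if j = k then b $ i else A $ i $ j"
  have cr: "matrix_inv (Smat F \<beta> h) *v b = (\<chi> k. det (?C (Smat F \<beta> h) k) / det (Smat F \<beta> h))"
    if "\<And>i. 0 \<le> h $ i" for h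
    using cramer[of "Smat F \<beta> h" "matrix_inv (Smat F \<beta> h) *v b" b]
      Smat_inv_vec[of \<beta> h F b] det_Smat_pos[of \<beta> h F] assms(1) that by simp
  have S: "((\<lambda>x. Smat F \<beta> (g x) $ i $ j) \<longlongrightarrow> Smat F \<beta> \<gamma> $ i $ j) G" for i j
    by (intro tendsto_vec_nth tendsto_Smat assms(2))
  have "((\<lambda>x. ?C (Smat F \<beta> (g x)) k $ i $ j) \<longlongrightarrow> ?C (Smat F \<beta> \<gamma>) k $ i $ j) G" for i j k
    using S by (cases "j = k") auto
  then have "((\<lambda>x. det (?C (Smat F \<beta> (g x)) k)) \<longlongrightarrow> det (?C (Smat F \<beta> \<gamma>) k)) G" for k
    by (rule tendsto_det)
  moreover have "((\<lambda>x. det (Smat F \<beta> (g x))) \<longlongrightarrow> det (Smat F \<beta> \<gamma>)) G"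
    by (rule tendsto_det) (rule S)
  moreover have "det (Smat F \<beta> \<gamma>) \<noteq> 0"
    using det_Smat_pos[OF assms(1,4)] by (metis less_irrefl)
  ultimately show ?thesis
    unfolding cr[OF assms(3)] cr[OF assms(4)] by (intro tendsto_vec_lambda tendsto_divide)
qed

section \<open>Variational form of the data term and bounds on the cost\<close>

lemma post_mean_nth:
  "post_mean F y \<beta> \<gamma> $ i = \<gamma> $ i * (matrix_inv (Smat F \<beta> \<gamma>) *v y v* F) $ i"
  by (simp add: post_mean_def diag_mat_mult_vec flip: matrix_vector_mul_assoc)

text \<open>With w = S^(-1) y and r = y - F x, completing squares bounds 2 w . r by the residual
  term and 2 w . F x by the penalty term, up to terms in w alone. The left sides add up to 2 w . y,
  and the terms in w alone to w . S w = w . y.\<close>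

lemma inner_Smat_inv_le:
  fixes F :: "real^'n^'m" and y :: "real^'m"
  assumes "\<beta> > 0" "\<And>i. 0 < \<gamma> $ i"
  shows "y \<bullet> (matrix_inv (Smat F \<beta> \<gamma>) *v y)
    \<le> \<beta> * ((y - F *v x) \<bullet> (y - F *v x)) + (\<Sum>i\<in>UNIV. (x $ i)\<^sup>2 / \<gamma> $ i)"
proof -
  let ?w = "matrix_inv (Smat F \<beta> \<gamma>) *v y" and ?r = "y - F *v x"
  have nonneg: "0 \<le> \<gamma> $ i" for i using assms(2)[of i] by simp
  have "0 \<le> \<beta> * ((?r - inverse \<beta> *\<^sub>R ?w) \<bullet> (?r - inverse \<beta> *\<^sub>R ?w))"
    using assms(1) by simp
  \<comment> \<open>Stated for free vectors, so that expanding the differences does not break up the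
    residual \<open>?r\<close> itself.\<close>
  also have "\<beta> * ((r - inverse \<beta> *\<^sub>R w) \<bullet> (r - inverse \<beta> *\<^sub>R w))
      = \<beta> * (r \<bullet> r) - 2 * (w \<bullet> r) + inverse \<beta> * (w \<bullet> w)" for r w :: "real^'m"
    using assms(1) by (simp add: inner_diff_left inner_diff_right inner_commute algebra_simps) (simp add: field_simps)
  finally have 1: "2 * (?w \<bullet> ?r) \<le> \<beta> * (?r \<bullet> ?r) + inverse \<beta> * (?w \<bullet> ?w)" by simp
  have "2 * ((?w v* F) $ i * x $ i) \<le> (x $ i)\<^sup>2 / \<gamma> $ i + \<gamma> $ i * (?w v* F) $ i * (?w v* F) $ i" for i
  proof -
    have "0 \<le> (x $ i - \<gamma> $ i * (?w v* F) $ i)\<^sup>2 / \<gamma> $ i"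
      using nonneg by simp
    also have "\<dots> = (x $ i)\<^sup>2 / \<gamma> $ i + \<gamma> $ i * (?w v* F) $ i * (?w v* F) $ i - 2 * ((?w v* F) $ i * x $ i)"
      using assms(2)[of i] by (simp add: power2_eq_square field_simps)
    finally show ?thesis by simp
  qed
  then have "(\<Sum>i\<in>UNIV. 2 * ((?w v* F) $ i * x $ i))
    \<le> (\<Sum>i\<in>UNIV. (x $ i)\<^sup>2 / \<gamma> $ i + \<gamma> $ i * (?w v* F) $ i * (?w v* F) $ i)"
    by (rule sum_mono)
  then have 2: "2 * (?w \<bullet> (F *v x)) \<le> (\<Sum>i\<in>UNIV. (x $ i)\<^sup>2 / \<gamma> $ i)
      + (\<Sum>i\<in>UNIV. \<gamma> $ i * (?w v* F) $ i * (?w v* F) $ i)"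
    by (subst dot_lmul_matrix[symmetric]) (simp add: inner_vec_def sum.distrib sum_distrib_left)
  have "?w \<bullet> (Smat F \<beta> \<gamma> *v ?w) = ?w \<bullet> y"
    by (simp add: Smat_inv_vec[OF assms(1) nonneg])
  then have "?w \<bullet> y = inverse \<beta> * (?w \<bullet> ?w) + (\<Sum>i\<in>UNIV. \<gamma> $ i * (?w v* F) $ i * (?w v* F) $ i)"
    by (simp add: inner_Smat)
  moreover have "?w \<bullet> ?r = ?w \<bullet> y - ?w \<bullet> (F *v x)" "y \<bullet> ?w = ?w \<bullet> y"
    by (simp_all only: inner_diff_right inner_commute[of y])
  ultimately show ?thesis using 1 2 by linarith
qed

text \<open>At the posterior mean both squares of the preceding inequality vanish: the residual is
  \<open>inverse \<beta>\<close> times w, and x_i = \<gamma>_i (F^T w)_i.\<close>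

lemma inner_Smat_inv_eq:
  fixes F :: "real^'n^'m" and y :: "real^'m"
  assumes "\<beta> > 0" "\<And>i. 0 < \<gamma> $ i"
  defines "x \<equiv> post_mean F y \<beta> \<gamma>"
  shows "y \<bullet> (matrix_inv (Smat F \<beta> \<gamma>) *v y)
    = \<beta> * ((y - F *v x) \<bullet> (y - F *v x)) + (\<Sum>i\<in>UNIV. (x $ i)\<^sup>2 / \<gamma> $ i)"
proof -
  let ?w = "matrix_inv (Smat F \<beta> \<gamma>) *v y"
  have nonneg: "0 \<le> \<gamma> $ i" for i using assms(2)[of i] by simp
  have x: "x = (\<chi> i. \<gamma> $ i * (?w v* F) $ i)"
    by (simp add: vec_eq_iff x_def post_mean_nth)
  have "y = inverse \<beta> *\<^sub>R ?w + F *v x"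
    using Smat_inv_vec[OF assms(1) nonneg, of F y] by (simp add: Smat_mult_vec x)
  then have r: "y - F *v x = inverse \<beta> *\<^sub>R ?w" by (metis add_diff_cancel)
  have sq: "(x $ i)\<^sup>2 / \<gamma> $ i = \<gamma> $ i * (?w v* F) $ i * (?w v* F) $ i" for i
    using assms(2)[of i] by (simp add: x power2_eq_square)
  have "y \<bullet> ?w = ?w \<bullet> (Smat F \<beta> \<gamma> *v ?w)"
    by (simp add: Smat_inv_vec[OF assms(1) nonneg] inner_commute)
  then show ?thesis using assms(1) by (simp add: inner_Smat r sq)
qed

text \<open>The same x serves for both parameters: it is optimal for \<gamma> and merely admissible
  for \<gamma>'. The residual terms therefore cancel, and only the penalties and the tangent of log
  det S remain.\<close>

lemma cost_descent:
  fixes F :: "real^'n^'m" and y :: "real^'m"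
  assumes "\<beta> > 0" "\<And>i. 0 < \<gamma> $ i" "\<And>i. 0 < \<gamma>' $ i"
  defines "x \<equiv> post_mean F y \<beta> \<gamma>"
  shows "cost F y \<beta> \<gamma>' \<le> cost F y \<beta> \<gamma> +
    (\<Sum>i\<in>UNIV. (x $ i)\<^sup>2 * (1 / \<gamma>' $ i - 1 / \<gamma> $ i) + (\<gamma>' $ i - \<gamma> $ i) * Zmat F \<beta> \<gamma> $ i $ i)"
  using inner_Smat_inv_le[OF assms(1,3), where F=F and y=y and x=x] inner_Smat_inv_eq[OF assms(1,2), where F=F and y=y]
    ln_det_Smat_le_tangent[OF assms(1) less_imp_le[OF assms(2)] less_imp_le[OF assms(3)], where F=F]
  by (simp add: cost_def x_def[symmetric] sum.distrib sum_subtractf right_diff_distrib)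

text \<open>The tangent at \<gamma> is evaluated at 0, where its linear part is minus a sum of
  nonnegative terms; the data term is nonnegative.\<close>

lemma cost_lower_bound:
  assumes "\<beta> > 0" "\<And>i. 0 \<le> \<gamma> $ i"
  shows "ln (det (Smat F \<beta> 0)) \<le> cost F y \<beta> \<gamma>"
proof -
  have "0 \<le> (\<Sum>i\<in>UNIV. \<gamma> $ i * Zmat F \<beta> \<gamma> $ i $ i)"
    by (intro sum_nonneg mult_nonneg_nonneg assms(2) Zmat_diag_nonneg[OF assms])
  with ln_det_Smat_le_tangent[OF assms, where \<gamma>'=0 and F=F] inner_Smat_inv_nonneg[OF assms, where v=y and F=F]
  show ?thesis by (simp add: cost_def sum_negf)
qed

text \<open>The Sherman-Morrison formula for the change s f f^T of S, with f the i-th column of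
  \<open>F\<close>. The bound on s keeps the shifted vector in the nonnegative orthant.\<close>

lemma inner_Smat_inv_rank_one:
  fixes F :: "real^'n^'m" and y :: "real^'m"
  assumes "\<beta> > 0" "\<And>j. 0 \<le> \<gamma> $ j" "- (\<gamma> $ i) < s"
  defines "u \<equiv> (matrix_inv (Smat F \<beta> \<gamma>) *v y v* F) $ i" and "z \<equiv> Zmat F \<beta> \<gamma> $ i $ i"
  shows "y \<bullet> (matrix_inv (Smat F \<beta> (\<gamma> + s *\<^sub>R axis i 1)) *v y)
    = y \<bullet> (matrix_inv (Smat F \<beta> \<gamma>) *v y) - s * u\<^sup>2 / (1 + s * z)"
proof -
  let ?g = "\<gamma> + s *\<^sub>R axis i 1" and ?f = "column i F"
  let ?w = "matrix_inv (Smat F \<beta> \<gamma>) *v y" and ?p = "matrix_inv (Smat F \<beta> \<gamma>) *v ?f"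
  let ?w' = "matrix_inv (Smat F \<beta> ?g) *v y"
  have g: "0 \<le> ?g $ j" for j using assms(2)[of j] assms(3) by (auto simp: axis_def)
  have bil: "a \<bullet> (Smat F \<beta> ?g *v b) = a \<bullet> (Smat F \<beta> \<gamma> *v b) + s * (a \<bullet> ?f) * (b \<bullet> ?f)" for a b
  proof -
    have "(\<Sum>j\<in>UNIV. ?g $ j * (a v* F) $ j * (b v* F) $ j)
      = (\<Sum>j\<in>UNIV. \<gamma> $ j * (a v* F) $ j * (b v* F) $ j + (if j = i then s * (a v* F) $ i * (b v* F) $ i else 0))"
      by (rule sum.cong) (auto simp: axis_def algebra_simps)
    then show ?thesis by (simp add: inner_Smat sum.distrib vector_matrix_mult_nth)
  qed
  have z: "?p \<bullet> ?f = z" "?f \<bullet> ?p = z" by (simp_all add: z_def Zmat_nth inner_commute)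
  have u: "?w \<bullet> ?f = u" "?f \<bullet> ?w = u" by (simp_all add: u_def vector_matrix_mult_nth inner_commute)
  \<comment> \<open>Pairing the old and the new S with w and w' gives one equation in the unknown w'
    . f; pairing with p and w' gives a second one, which determines w' . f.\<close>
  have "?w \<bullet> y = ?w' \<bullet> y + s * u * (?w' \<bullet> ?f)"
    using bil[of ?w ?w'] inner_Smat_commute[of ?w F \<beta> \<gamma> ?w']
    by (simp add: Smat_inv_vec[OF assms(1,2)] Smat_inv_vec[OF assms(1) g] u inner_commute)
  moreover have "u = (?w' \<bullet> ?f) * (1 + s * z)"
    using bil[of ?p ?w'] inner_Smat_commute[of ?p F \<beta> \<gamma> ?w'] u
      inner_Smat_inv_commute[OF assms(1,2), of y F ?f]
    by (simp add: Smat_inv_vec[OF assms(1,2)] Smat_inv_vec[OF assms(1) g] z inner_commute algebra_simps)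
  \<comment> \<open>For negative s the bound s > -\<gamma>_i combines with \<gamma>_i z <=
    1.\<close>
  moreover have "0 < 1 + s * z"
  proof (cases "0 \<le> s \<or> z = 0")
    case False
    with Zmat_diag_nonneg[OF assms(1,2), of F i] have "0 < z" by (auto simp: z_def less_le)
    with assms(3) have "- s * z < \<gamma> $ i * z" by (intro mult_strict_right_mono) auto
    also have "\<dots> \<le> 1" unfolding z_def by (rule mult_Zmat_diag_le_1[OF assms(1,2)])
    finally show ?thesis by simp
  qed (use Zmat_diag_nonneg[OF assms(1,2), of F i] in \<open>auto simp: z_def intro: add_pos_nonneg\<close>)
  ultimately show ?thesis
    by (simp add: inner_commute power2_eq_square)
qed

text \<open>The log-determinant contributes Z_ii; the rank-one formula, differentiated at s = 0,
  contributes minus the square of the i-th coordinate of F^T S^(-1) y.\<close>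

lemma cost_has_partial_derivative:
  fixes F :: "real^'n^'m" and y :: "real^'m"
  assumes "\<beta> > 0" "\<And>j. 0 \<le> \<gamma> $ j" "0 < \<gamma> $ i"
  shows "has_partial_derivative (cost F y \<beta>) i \<gamma>
    (Zmat F \<beta> \<gamma> $ i $ i - ((matrix_inv (Smat F \<beta> \<gamma>) *v y v* F) $ i)\<^sup>2)"
proof -
  let ?u = "(matrix_inv (Smat F \<beta> \<gamma>) *v y v* F) $ i" and ?z = "Zmat F \<beta> \<gamma> $ i $ i"
  let ?g = "\<lambda>s. \<gamma> + s *\<^sub>R axis i 1"
  have d: "((\<lambda>s. y \<bullet> (matrix_inv (Smat F \<beta> \<gamma>) *v y) - s * ?u\<^sup>2 / (1 + s * ?z)) has_real_derivative - ?u\<^sup>2) (at 0)"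
    by (auto intro!: derivative_eq_intros)
  \<comment> \<open>The rank-one formula holds for s > -\<gamma>_i, which is a neighbourhood of 0
    because \<gamma>_i is positive.\<close>
  have "eventually (\<lambda>s. s \<in> {- (\<gamma> $ i)<..}) (nhds 0)"
    using assms(3) by (intro eventually_nhds_in_open) auto
  then have ev: "eventually (\<lambda>s. y \<bullet> (matrix_inv (Smat F \<beta> \<gamma>) *v y) - s * ?u\<^sup>2 / (1 + s * ?z)
      = y \<bullet> (matrix_inv (Smat F \<beta> (?g s)) *v y)) (nhds 0)"
    by eventually_elim (simp add: inner_Smat_inv_rank_one[OF assms(1,2)])
  have "((\<lambda>s. y \<bullet> (matrix_inv (Smat F \<beta> (?g s)) *v y)) has_real_derivative - ?u\<^sup>2) (at 0)"
    using DERIV_cong_ev[OF refl ev refl, THEN iffD1, OF d] .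
  moreover have "((\<lambda>s. ln (det (Smat F \<beta> (?g s)))) has_real_derivative ?z) (at 0)"
    using DERIV_ln_det_Smat_line[OF assms(1), of \<gamma> 0 "axis i 1" F] assms(2)
    by (simp add: axis_def if_distrib[where f = "\<lambda>a. a * _"] cong: if_cong)
  ultimately have "((\<lambda>s. cost F y \<beta> (?g s)) has_real_derivative ?z - ?u\<^sup>2) (at (\<gamma> $ i + - (\<gamma> $ i)))"
    unfolding cost_def using DERIV_add by fastforce
  then have "((\<lambda>t. cost F y \<beta> (?g (t + - (\<gamma> $ i)))) has_real_derivative ?z - ?u\<^sup>2) (at (\<gamma> $ i))"
    by (simp only: DERIV_shift)
  moreover have "?g (t + - (\<gamma> $ i)) = (\<chi> j. if j = i then t else \<gamma> $ j)" for t
    by (auto simp: vec_eq_iff axis_def)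
  ultimately show ?thesis unfolding has_partial_derivative_def by simp
qed

text \<open>The deviation from the tangent is computed exactly: with a and b the reciprocals of
  \<theta> and \<theta>', it is (a^2 z) (2ab + b^2) (\<theta>' - \<theta>)^2. Here a^2 z <= 1 and
  2ab + b^2 <= a^2 + 2 b^2 <= 3 R.\<close>

lemma theta_step_remainder:
  fixes \<theta> \<theta>' R z :: real
  assumes "0 < \<theta>" "0 < \<theta>'" "1 / \<theta>\<^sup>2 \<le> R" "1 / \<theta>'\<^sup>2 \<le> R" "0 \<le> z" "1 / \<theta>\<^sup>2 * z \<le> 1"
  shows "(1 / \<theta>'\<^sup>2 - 1 / \<theta>\<^sup>2) * z \<le> - 2 * (\<theta>' - \<theta>) * (z / \<theta> ^ 3) + 3 * R * (\<theta>' - \<theta>)\<^sup>2"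
proof -
  let ?a = "1 / \<theta>" and ?b = "1 / \<theta>'"
  have "(1 / \<theta>'\<^sup>2 - 1 / \<theta>\<^sup>2) * z + 2 * (\<theta>' - \<theta>) * (z / \<theta> ^ 3)
    = (1 / \<theta>\<^sup>2 * z) * ((2 * ?a * ?b + ?b\<^sup>2) * (\<theta>' - \<theta>)\<^sup>2)"
    using assms(1,2) by (simp add: field_simps power2_eq_square power3_eq_cube)
  also have "\<dots> \<le> 1 * ((2 * ?a * ?b + ?b\<^sup>2) * (\<theta>' - \<theta>)\<^sup>2)"
    using assms by (intro mult_right_mono) auto
  also have "\<dots> \<le> 3 * R * (\<theta>' - \<theta>)\<^sup>2"
  proof -
    have "2 * ?a * ?b \<le> ?a\<^sup>2 + ?b\<^sup>2" by (rule sum_squares_bound)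
    with assms(3,4) have "2 * ?a * ?b + ?b\<^sup>2 \<le> 3 * R" by (simp add: power_divide)
    then show ?thesis by (simp add: mult_right_mono)
  qed
  finally show ?thesis by linarith
qed

subsection \<open>The AMQ iteration\<close>

text \<open>The quadratic part expands exactly and the other part is bounded by
  \<open>theta_step_remainder\<close>. Assumption \<open>h\<close>, the equation of the half step,
  makes the terms linear in the step collapse to the summand of A, since those containing
  \<open>\<xi>\<^sup>2 * \<theta>\<close> cancel.\<close>

lemma AMQ_coordinate_decrease:
  fixes \<theta> h \<eta> \<xi> z \<tau> R :: real
  defines "\<theta>' \<equiv> \<theta> + \<eta> * (h - \<theta>)"
  assumes "0 < \<theta>" "0 < \<theta>'" "1 / \<theta>\<^sup>2 \<le> R" "1 / \<theta>'\<^sup>2 \<le> R" "0 \<le> z" "1 / \<theta>\<^sup>2 * z \<le> 1" "0 < R"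
    and h: "(\<xi>\<^sup>2 + \<tau>) * (h - \<theta>) = z / \<theta> ^ 3 - \<xi>\<^sup>2 * \<theta>"
  shows "\<xi>\<^sup>2 * (\<theta>'\<^sup>2 - \<theta>\<^sup>2) + (1 / \<theta>'\<^sup>2 - 1 / \<theta>\<^sup>2) * z
    \<le> - 2 * (\<eta> * ((\<xi>\<^sup>2 + \<tau>) * (h - \<theta>)\<^sup>2)) + 2 * (\<eta>\<^sup>2 * ((\<xi>\<^sup>2 + 9 * R / 5) * (h - \<theta>)\<^sup>2))"
proof -
  let ?d = "h - \<theta>"
  have diff: "\<theta>' - \<theta> = \<eta> * ?d" by (simp add: \<theta>'_def)
  have z: "z / \<theta> ^ 3 = (\<xi>\<^sup>2 + \<tau>) * ?d + \<xi>\<^sup>2 * \<theta>" using h by simp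
  have "(1 / \<theta>'\<^sup>2 - 1 / \<theta>\<^sup>2) * z \<le> - 2 * (\<eta> * ?d) * ((\<xi>\<^sup>2 + \<tau>) * ?d + \<xi>\<^sup>2 * \<theta>) + 3 * R * (\<eta> * ?d)\<^sup>2"
    using theta_step_remainder[OF assms(2-7)] unfolding diff z .
  moreover have "\<theta>'\<^sup>2 - \<theta>\<^sup>2 = 2 * \<eta> * ?d * \<theta> + (\<eta> * ?d)\<^sup>2"
    by (simp add: \<theta>'_def power2_eq_square algebra_simps)
  ultimately have "\<xi>\<^sup>2 * (\<theta>'\<^sup>2 - \<theta>\<^sup>2) + (1 / \<theta>'\<^sup>2 - 1 / \<theta>\<^sup>2) * z
      \<le> \<xi>\<^sup>2 * (2 * \<eta> * ?d * \<theta> + (\<eta> * ?d)\<^sup>2)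
        + (- 2 * (\<eta> * ?d) * ((\<xi>\<^sup>2 + \<tau>) * ?d + \<xi>\<^sup>2 * \<theta>) + 3 * R * (\<eta> * ?d)\<^sup>2)"
    by simp
  also have "\<dots> = - 2 * (\<eta> * ((\<xi>\<^sup>2 + \<tau>) * ?d\<^sup>2)) + (\<xi>\<^sup>2 + 3 * R) * (\<eta> * ?d)\<^sup>2"
    by (simp add: power2_eq_square algebra_simps)
  \<comment> \<open>The constant 9/5 in B enters here: twice it is 18/5, which covers the 3 of the
    remainder.\<close>
  also have "(\<xi>\<^sup>2 + 3 * R) * (\<eta> * ?d)\<^sup>2 \<le> (2 * (\<xi>\<^sup>2 + 9 * R / 5)) * (\<eta> * ?d)\<^sup>2"
  proof (rule mult_right_mono)
    show "\<xi>\<^sup>2 + 3 * R \<le> 2 * (\<xi>\<^sup>2 + 9 * R / 5)"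
      using assms(8) zero_le_power2[of \<xi>] by argo
  qed simp
  also have "2 * (\<xi>\<^sup>2 + 9 * R / 5) * (\<eta> * ?d)\<^sup>2 = 2 * (\<eta>\<^sup>2 * ((\<xi>\<^sup>2 + 9 * R / 5) * ?d\<^sup>2))"
    by (simp only: power_mult_distrib mult_ac)
  finally show ?thesis by (simp only: add_left_mono)
qed

text \<open>Eventually \<open>E k\<close> exceeds e/2, so the weights are dominated by 2/e times a
  summable sequence.\<close>

lemma summable_weights_of_mult:
  fixes \<eta> E A :: "nat \<Rightarrow> real"
  assumes "summable A" "E \<longlonglongrightarrow> e" "0 < e" "\<And>k. 0 \<le> \<eta> k" "\<And>k. \<eta> k * E k \<le> A k"
  shows "summable \<eta>"
proof (rule summable_comparison_test_ev)
  have "eventually (\<lambda>k. e / 2 < E k) sequentially"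
    using assms(2,3) by (intro order_tendstoD(1)) auto
  then show "eventually (\<lambda>k. norm (\<eta> k) \<le> A k * (2 / e)) sequentially"
  proof eventually_elim
    case (elim k)
    have "\<eta> k * (e / 2) \<le> \<eta> k * E k"
      using elim assms(4) by (intro mult_left_mono) auto
    also have "\<dots> \<le> A k" by (rule assms(5))
    finally show ?case using assms(3,4) by (simp add: field_simps)
  qed
qed (rule summable_mult2[OF assms(1)])

section \<open>Estimates along a fixed AMQ run\<close>

context
  fixes F :: "real^'n^'m" and y :: "real^'m" and \<beta> \<tau> R :: real
    and \<eta> :: "nat \<Rightarrow> real" and \<gamma> x \<theta> \<theta>h :: "nat \<Rightarrow> real^'n"
  assumes \<beta>: "\<beta> > 0" and \<tau>: "\<tau> > 0" and R: "R > 0"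
    and AMQ: "AMQ F y \<beta> \<tau> \<eta> \<gamma> x \<theta> \<theta>h"
    and \<gamma>_le: "\<And>k i. \<gamma> k $ i \<le> R"
begin

lemma AMQ_\<theta>_pos: "0 < \<theta> k $ i"
  using AMQ unfolding AMQ_def by blast

lemma AMQ_\<eta>_pos: "0 < \<eta> k"
  using AMQ unfolding AMQ_def by blast

lemma AMQ_\<gamma>_pos: "0 < \<gamma> k $ i"
proof (cases k)
  case 0
  then show ?thesis using AMQ unfolding AMQ_def by blast
next
  case (Suc l)
  have "\<gamma> (Suc l) $ i = (\<theta> (Suc l) $ i) powi (-2)" using AMQ unfolding AMQ_def by blast
  with Suc AMQ_\<theta>_pos[of k i] show ?thesis by simp
qed

lemma AMQ_\<gamma>_eq: "\<gamma> k $ i = 1 / (\<theta> k $ i)\<^sup>2"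
proof -
  have "\<theta> k $ i = \<gamma> k $ i powr (-1/2)" using AMQ unfolding AMQ_def by blast
  then have "(\<theta> k $ i)\<^sup>2 = \<gamma> k $ i powr (-1)"
    using AMQ_\<gamma>_pos[of k i] by (simp add: powr_power)
  also have "\<dots> = 1 / \<gamma> k $ i"
    using AMQ_\<gamma>_pos[of k i] by (simp add: powr_minus_divide)
  finally show ?thesis by simp
qed

lemma AMQ_x: "x k = post_mean F y \<beta> (\<gamma> k)"
  using AMQ unfolding AMQ_def by blast

text \<open>The half step with its denominator cleared; the right side is minus half the
  \<theta>_i-derivative, at the current iterate, of the sum of x_j^2 \<theta>_j^2 plus log det S
  with x frozen.\<close>

lemma AMQ_half_step:
  "((x k $ i)\<^sup>2 + \<tau>) * (\<theta>h k $ i - \<theta> k $ i)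
    = Zmat F \<beta> (\<gamma> k) $ i $ i / \<theta> k $ i ^ 3 - (x k $ i)\<^sup>2 * \<theta> k $ i"
proof -
  have "\<theta>h k $ i = ((\<theta> k $ i) powi (-3) * Zmat F \<beta> (\<gamma> k) $ i $ i + \<tau> * \<theta> k $ i) / ((x k $ i)\<^sup>2 + \<tau>)"
    using AMQ unfolding AMQ_def by blast
  moreover have "(x k $ i)\<^sup>2 + \<tau> \<noteq> 0" using \<tau> by (simp add: add_nonneg_pos less_imp_neq[THEN not_sym])
  ultimately have "((x k $ i)\<^sup>2 + \<tau>) * \<theta>h k $ i
      = (\<theta> k $ i) powi (-3) * Zmat F \<beta> (\<gamma> k) $ i $ i + \<tau> * \<theta> k $ i"
    by simp
  moreover have "(\<theta> k $ i) powi (-3) = 1 / \<theta> k $ i ^ 3"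
    by (simp add: power_int_minus_divide)
  ultimately show ?thesis by (simp add: algebra_simps)
qed

lemma AMQ_cost_decrease:
  "cost F y \<beta> (\<gamma> (Suc k)) \<le> cost F y \<beta> (\<gamma> k) - 2 * A_AMQ \<tau> \<eta> x \<theta> \<theta>h k + 2 * B_AMQ R \<eta> x \<theta> \<theta>h k"
proof -
  let ?d = "\<lambda>i. \<theta>h k $ i - \<theta> k $ i"
  have step: "\<theta> (Suc k) $ i = \<theta> k $ i + \<eta> k * ?d i" for i
    using AMQ unfolding AMQ_def by blast
  have "(x k $ i)\<^sup>2 * (1 / \<gamma> (Suc k) $ i - 1 / \<gamma> k $ i) + (\<gamma> (Suc k) $ i - \<gamma> k $ i) * Zmat F \<beta> (\<gamma> k) $ i $ i
     \<le> - 2 * (\<eta> k * (((x k $ i)\<^sup>2 + \<tau>) * (?d i)\<^sup>2)) + 2 * ((\<eta> k)\<^sup>2 * (((x k $ i)\<^sup>2 + 9 * R / 5) * (?d i)\<^sup>2))" for i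
  proof -
    have "0 \<le> Zmat F \<beta> (\<gamma> k) $ i $ i" "\<gamma> k $ i * Zmat F \<beta> (\<gamma> k) $ i $ i \<le> 1"
      using Zmat_diag_nonneg[OF \<beta>] mult_Zmat_diag_le_1[OF \<beta>] AMQ_\<gamma>_pos less_imp_le by blast+
    then show ?thesis
      using AMQ_coordinate_decrease[OF _ _ _ _ _ _ R AMQ_half_step[of k i], where \<eta> = "\<eta> k"]
        AMQ_\<theta>_pos[of k i] AMQ_\<theta>_pos[of "Suc k" i] \<gamma>_le[of k i] \<gamma>_le[of "Suc k" i]
      by (simp add: AMQ_\<gamma>_eq step)
  qed
  then have "(\<Sum>i\<in>UNIV. (x k $ i)\<^sup>2 * (1 / \<gamma> (Suc k) $ i - 1 / \<gamma> k $ i) + (\<gamma> (Suc k) $ i - \<gamma> k $ i) * Zmat F \<beta> (\<gamma> k) $ i $ i)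
     \<le> (\<Sum>i\<in>UNIV. - 2 * (\<eta> k * (((x k $ i)\<^sup>2 + \<tau>) * (?d i)\<^sup>2)) + 2 * ((\<eta> k)\<^sup>2 * (((x k $ i)\<^sup>2 + 9 * R / 5) * (?d i)\<^sup>2)))"
    by (rule sum_mono)
  also have "\<dots> = - 2 * A_AMQ \<tau> \<eta> x \<theta> \<theta>h k + 2 * B_AMQ R \<eta> x \<theta> \<theta>h k"
    by (simp add: A_AMQ_def B_AMQ_def sum.distrib sum_subtractf sum_distrib_left sum_negf)
  finally show ?thesis
    using cost_descent[OF \<beta> AMQ_\<gamma>_pos AMQ_\<gamma>_pos, of F y "Suc k" k] unfolding AMQ_x[symmetric] by linarith
qed

lemma AMQ_cost_lower_bound: "ln (det (Smat F \<beta> 0)) \<le> cost F y \<beta> (\<gamma> k)"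
  by (rule cost_lower_bound[OF \<beta> less_imp_le[OF AMQ_\<gamma>_pos]])

text \<open>Since x_i = \<gamma>_i u_i and \<gamma>_i = \<theta>_i^(-2), the term x_i^2 \<theta>_i
  equals u_i^2 / \<theta>_i^3. The half step is thus proportional to z - u^2, the partial derivative
  of the cost. Squaring turns \<theta>_i^(-6) into \<gamma>_i^3, and a single summand bounds the sum
  in A from below.\<close>

lemma AMQ_A_ge:
  defines "z \<equiv> \<lambda>k i. Zmat F \<beta> (\<gamma> k) $ i $ i"
    and "u \<equiv> \<lambda>k i. (matrix_inv (Smat F \<beta> (\<gamma> k)) *v y v* F) $ i"
  shows "\<eta> k * ((\<gamma> k $ i) ^ 3 * (z k i - (u k i)\<^sup>2)\<^sup>2 / ((\<gamma> k $ i * u k i)\<^sup>2 + \<tau>)) \<le> A_AMQ \<tau> \<eta> x \<theta> \<theta>h k"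
proof -
  let ?d = "\<lambda>i. \<theta>h k $ i - \<theta> k $ i"
  have x: "x k $ i = \<gamma> k $ i * u k i" by (simp add: AMQ_x post_mean_nth u_def)
  have pos: "0 < (x k $ i)\<^sup>2 + \<tau>" using \<tau> by (simp add: add_nonneg_pos)
  have "((x k $ i)\<^sup>2 + \<tau>) * ?d i = z k i / \<theta> k $ i ^ 3 - (x k $ i)\<^sup>2 * \<theta> k $ i"
    by (simp add: AMQ_half_step z_def)
  also have "\<dots> = (z k i - (u k i)\<^sup>2) / \<theta> k $ i ^ 3"
    using AMQ_\<theta>_pos[of k i] unfolding x
    by (simp add: AMQ_\<gamma>_eq power_mult_distrib power_divide field_simps eval_nat_numeral)
  finally have "((x k $ i)\<^sup>2 + \<tau>) * ?d i = (z k i - (u k i)\<^sup>2) / \<theta> k $ i ^ 3" .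
  then have "(((x k $ i)\<^sup>2 + \<tau>) * ?d i)\<^sup>2 = (\<gamma> k $ i) ^ 3 * (z k i - (u k i)\<^sup>2)\<^sup>2"
    by (simp add: AMQ_\<gamma>_eq power_divide flip: power_mult)
  then have "(\<gamma> k $ i) ^ 3 * (z k i - (u k i)\<^sup>2)\<^sup>2 / ((\<gamma> k $ i * u k i)\<^sup>2 + \<tau>) = ((x k $ i)\<^sup>2 + \<tau>) * (?d i)\<^sup>2"
    using pos unfolding x[symmetric] by (simp add: power2_eq_square field_simps)
  also have "\<dots> \<le> (\<Sum>i\<in>UNIV. ((x k $ i)\<^sup>2 + \<tau>) * (?d i)\<^sup>2)"
    using \<tau> by (intro member_le_sum) auto
  finally show ?thesis
    unfolding A_AMQ_def by (intro mult_left_mono less_imp_le[OF AMQ_\<eta>_pos])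
qed

lemma AMQ_A_nonneg: "0 \<le> A_AMQ \<tau> \<eta> x \<theta> \<theta>h k"
  using AMQ_\<eta>_pos[of k] \<tau> unfolding A_AMQ_def by (intro mult_nonneg_nonneg sum_nonneg) auto

lemma AMQ_tendsto:
  assumes "(\<lambda>k. \<gamma> (r k)) \<longlonglongrightarrow> \<gamma>s"
  shows "0 \<le> \<gamma>s $ i"
    and "(\<lambda>k. matrix_inv (Smat F \<beta> (\<gamma> (r k))) *v b) \<longlonglongrightarrow> matrix_inv (Smat F \<beta> \<gamma>s) *v b"
proof -
  show nonneg: "0 \<le> \<gamma>s $ i" for i
    by (rule LIMSEQ_le_const[OF tendsto_vec_nth[OF assms]]) (auto intro: less_imp_le AMQ_\<gamma>_pos)
  show "(\<lambda>k. matrix_inv (Smat F \<beta> (\<gamma> (r k))) *v b) \<longlonglongrightarrow> matrix_inv (Smat F \<beta> \<gamma>s) *v b"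
    by (rule tendsto_Smat_inv_vec[OF \<beta> assms less_imp_le[OF AMQ_\<gamma>_pos] nonneg])
qed

text \<open>The \<gamma>-iterates stay in a compact box. Since x is a continuous function of
  \<gamma> on the nonnegative orthant, it converges along the same subsequence.\<close>

lemma AMQ_subseq:
  "\<exists>r::nat \<Rightarrow> nat. strict_mono r \<and> convergent (\<lambda>k. x (r k)) \<and> convergent (\<lambda>k. \<gamma> (r k))"
proof -
  have "\<gamma> k \<in> cbox 0 (\<chi> i. R)" for k
    using \<gamma>_le AMQ_\<gamma>_pos by (auto simp: mem_box_cart intro: less_imp_le)
  then obtain \<gamma>s r where r: "strict_mono r" and lim: "(\<lambda>k. \<gamma> (r k)) \<longlonglongrightarrow> \<gamma>s"
    using compact_cbox unfolding compact_def comp_def by metis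
  have "(\<lambda>k. x (r k)) \<longlonglongrightarrow> (\<chi> i. \<gamma>s $ i * ((matrix_inv (Smat F \<beta> \<gamma>s) *v y) \<bullet> column i F))"
    by (rule vec_tendstoI)
      (auto simp: AMQ_x post_mean_nth vector_matrix_mult_nth intro!: tendsto_intros lim AMQ_tendsto(2))
  with r lim show ?thesis by (auto simp: convergent_def)
qed

lemma AMQ_limit_stationary:
  fixes r :: "nat \<Rightarrow> nat"
  assumes r: "strict_mono r" and lim: "(\<lambda>k. \<gamma> (r k)) \<longlonglongrightarrow> \<gamma>s"
    and diverges: "filterlim (\<lambda>N. \<Sum>k<N. \<eta> (r k)) at_top sequentially"
    and \<kappa>: "\<kappa> < 1" and BA: "\<And>k. B_AMQ R \<eta> x \<theta> \<theta>h k \<le> \<kappa> * A_AMQ \<tau> \<eta> x \<theta> \<theta>h k"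
    and nz: "\<gamma>s $ i \<noteq> 0"
  shows "has_partial_derivative (cost F y \<beta>) i \<gamma>s 0"
proof -
  let ?A = "A_AMQ \<tau> \<eta> x \<theta> \<theta>h"
  define z where "z = (\<lambda>g. column i F \<bullet> (matrix_inv (Smat F \<beta> g) *v column i F))"
  define u where "u = (\<lambda>g. (matrix_inv (Smat F \<beta> g) *v y) \<bullet> column i F)"
  have pos: "0 < \<gamma>s $ i" using AMQ_tendsto(1)[OF lim, of i] nz by (metis less_le)
  have \<tau>_pos: "0 < a\<^sup>2 + \<tau>" for a :: real using \<tau> by (simp add: add_nonneg_pos)
  have z_lim: "(\<lambda>k. z (\<gamma> (r k))) \<longlonglongrightarrow> z \<gamma>s" and u_lim: "(\<lambda>k. u (\<gamma> (r k))) \<longlonglongrightarrow> u \<gamma>s"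
    unfolding z_def u_def
    by (rule tendsto_inner[OF tendsto_const AMQ_tendsto(2)[OF lim]],
        rule tendsto_inner[OF AMQ_tendsto(2)[OF lim] tendsto_const])
  have "z \<gamma>s = (u \<gamma>s)\<^sup>2"
  proof (rule ccontr)
    assume "z \<gamma>s \<noteq> (u \<gamma>s)\<^sup>2"
    \<comment> \<open>\<open>E\<close> is the factor of \<open>\<eta> k\<close> in
      \<open>AMQ_A_ge\<close>, as a function of \<gamma>. A nonzero derivative at the limit makes it
      positive there, hence bounded away from 0 along the tail of the subsequence.\<close>
    define E where "E = (\<lambda>g. (g $ i) ^ 3 * (z g - (u g)\<^sup>2)\<^sup>2 / ((g $ i * u g)\<^sup>2 + \<tau>))"
    have E_pos: "0 < E \<gamma>s"
      unfolding E_def using pos \<tau>_pos \<open>z \<gamma>s \<noteq> (u \<gamma>s)\<^sup>2\<close>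
      by (intro divide_pos_pos mult_pos_pos) simp_all
    have "(\<gamma>s $ i * u \<gamma>s)\<^sup>2 + \<tau> \<noteq> 0" using \<tau>_pos by (metis less_irrefl)
    then have E_lim: "(\<lambda>k. E (\<gamma> (r k))) \<longlonglongrightarrow> E \<gamma>s"
      unfolding E_def by (intro tendsto_divide tendsto_mult tendsto_power tendsto_diff
          tendsto_add tendsto_const tendsto_vec_nth[OF lim] z_lim u_lim)
    have E_le: "\<eta> (r k) * E (\<gamma> (r k)) \<le> ?A (r k)" for k
      using AMQ_A_ge[of "r k" i] by (simp add: E_def z_def u_def Zmat_nth vector_matrix_mult_nth)
    \<comment> \<open>Summability is proved along the whole run, where consecutive costs telescope;
      nonnegativity of the terms then passes it on to the subsequence.\<close>
    have "summable ?A"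
    proof (rule summableI_nonneg_bounded[OF AMQ_A_nonneg])
      fix n
      \<comment> \<open>The bound by \<kappa> leaves at least the fraction 1 - \<kappa> of the
        decrease 2 A.\<close>
      have dec: "2 * (1 - \<kappa>) * ?A k \<le> cost F y \<beta> (\<gamma> k) - cost F y \<beta> (\<gamma> (Suc k))" for k
        using AMQ_cost_decrease[of k] BA[of k] by (simp add: algebra_simps)
      have "2 * (1 - \<kappa>) * (\<Sum>k<n. ?A k) \<le> (\<Sum>k<n. cost F y \<beta> (\<gamma> k) - cost F y \<beta> (\<gamma> (Suc k)))"
        unfolding sum_distrib_left by (intro sum_mono dec)
      also have "\<dots> = cost F y \<beta> (\<gamma> 0) - cost F y \<beta> (\<gamma> n)" by (rule sum_lessThan_telescope')
      also have "\<dots> \<le> cost F y \<beta> (\<gamma> 0) - ln (det (Smat F \<beta> 0))"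
        using AMQ_cost_lower_bound[of n] by simp
      finally show "(\<Sum>k<n. ?A k) \<le> (cost F y \<beta> (\<gamma> 0) - ln (det (Smat F \<beta> 0))) / (2 * (1 - \<kappa>))"
        using \<kappa> by (subst pos_le_divide_eq) (auto simp: mult.commute)
    qed
    then have "summable (?A \<circ> r)"
      by (rule summable_reindex) (auto simp: strict_mono_imp_inj_on[OF r] AMQ_A_nonneg)
    then have "summable (\<lambda>k. \<eta> (r k))"
      using summable_weights_of_mult[OF _ E_lim E_pos less_imp_le[OF AMQ_\<eta>_pos] E_le] by (simp add: comp_def)
    then show False
      using not_tendsto_and_filterlim_at_infinity[OF sequentially_bot summable_LIMSEQ]
        filterlim_at_top_imp_at_infinity[OF diverges] by blast
  qed
  then show "has_partial_derivative (cost F y \<beta>) i \<gamma>s 0"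
    using cost_has_partial_derivative[OF \<beta> AMQ_tendsto(1)[OF lim] pos, of F y]
    by (simp add: Zmat_nth vector_matrix_mult_nth z_def u_def)
qed

end

theorem theorem5p3:
  fixes F :: "real^'n^'m" and y :: "real^'m" and \<beta> \<tau> R :: real
    and \<eta> :: "nat \<Rightarrow> real" and \<gamma> x \<theta> \<theta>h :: "nat \<Rightarrow> real^'n"
  assumes "\<beta> > 0" and "\<tau> > 0" and "R > 0"
    and "AMQ F y \<beta> \<tau> \<eta> \<gamma> x \<theta> \<theta>h"
    and "\<And>k i. \<gamma> k $ i \<le> R"
    and "\<And>k. B_AMQ R \<eta> x \<theta> \<theta>h k \<le> A_AMQ \<tau> \<eta> x \<theta> \<theta>h k"
  shows "(decseq (\<lambda>k. cost F y \<beta> (\<gamma> k)) \<and> convergent (\<lambda>k. cost F y \<beta> (\<gamma> k))) \<and>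
    (\<exists>r::nat \<Rightarrow> nat. strict_mono r \<and> convergent (\<lambda>k. x (r k)) \<and> convergent (\<lambda>k. \<gamma> (r k))) \<and>
    (\<forall>(r::nat \<Rightarrow> nat) \<gamma>s. strict_mono r \<and> convergent (\<lambda>k. x (r k)) \<and>
        (\<lambda>k. \<gamma> (r k)) \<longlonglongrightarrow> \<gamma>s \<and>
        filterlim (\<lambda>N. \<Sum>k<N. \<eta> (r k)) at_top sequentially \<and>
        (\<exists>\<kappa>. 0 \<le> \<kappa> \<and> \<kappa> < 1 \<and>
           (\<forall>k. B_AMQ R \<eta> x \<theta> \<theta>h k \<le> \<kappa> * A_AMQ \<tau> \<eta> x \<theta> \<theta>h k)) \<longrightarrow>
        (\<forall>i. \<gamma>s $ i = 0 \<or> has_partial_derivative (cost F y \<beta>) i \<gamma>s 0))"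
proof (intro conjI)
  show dec: "decseq (\<lambda>k. cost F y \<beta> (\<gamma> k))"
    \<comment> \<open>The guaranteed decrease 2 (A - B) is nonnegative by the choice of the step
      sizes.\<close>
    using AMQ_cost_decrease[OF assms(1-5)] assms(6) by (intro decseq_SucI) (smt (verit))
  show "convergent (\<lambda>k. cost F y \<beta> (\<gamma> k))"
    using decseq_convergent[OF dec allI[OF AMQ_cost_lower_bound[OF assms(1-5)]]] by (metis convergentI)
  show "\<exists>r::nat \<Rightarrow> nat. strict_mono r \<and> convergent (\<lambda>k. x (r k)) \<and> convergent (\<lambda>k. \<gamma> (r k))"
    by (rule AMQ_subseq[OF assms(1-5)])
  show "\<forall>(r::nat \<Rightarrow> nat) \<gamma>s. strict_mono r \<and> convergent (\<lambda>k. x (r k)) \<and>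
        (\<lambda>k. \<gamma> (r k)) \<longlonglongrightarrow> \<gamma>s \<and>
        filterlim (\<lambda>N. \<Sum>k<N. \<eta> (r k)) at_top sequentially \<and>
        (\<exists>\<kappa>. 0 \<le> \<kappa> \<and> \<kappa> < 1 \<and>
           (\<forall>k. B_AMQ R \<eta> x \<theta> \<theta>h k \<le> \<kappa> * A_AMQ \<tau> \<eta> x \<theta> \<theta>h k)) \<longrightarrow>
        (\<forall>i. \<gamma>s $ i = 0 \<or> has_partial_derivative (cost F y \<beta>) i \<gamma>s 0)"
    using AMQ_limit_stationary[OF assms(1-5)] by meson
qed

end
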